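(* For each real number $\lambda>0$ there exists $n_0(\lambda)$ such that for all $X \ge n_0(\lambda)$, $$N_{\lambda}(X) := \#\{ n \in \mathbb{Z} : 1 \le n \le X \text{ and the ternary expansion } (\lfloor \lambda 2^n\rfloor)_3 \text{ omits the digit } 2\} \le 25\, X^{0.9725}.$$
   Context: For a nonnegative integer $k$, $(k)_3$ denotes its ternary (base 3) digit expansion, with digits in $\{0,1,2\}$; it "omits the digit 2" if every digit is $0$ or $1$. $\lfloor x\rfloor$ is the floor of the real number $x$. *)

theory Defs
  imports Complex_Main
begin

text \<open>The digit of weight \<open>3 ^ i\<close> in the base 3 expansion of \<open>k\<close>. Positions beyond the
  leading digit yield \<open>0\<close>, which is harmless when asking whether the digit \<open>2\<close> occurs.\<close>

definition ternary_digit :: "nat \<Rightarrow> nat \<Rightarrow> nat" where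
  "ternary_digit k i = k div 3 ^ i mod 3"

definition omits_digit_2 :: "nat \<Rightarrow> bool" where
  "omits_digit_2 k \<longleftrightarrow> (\<forall>i. ternary_digit k i \<noteq> 2)"

text \<open>The cut-off \<open>X\<close> is real. The floor is nonnegative for \<open>lam > 0\<close>, so the conversion
  \<open>nat\<close> then loses nothing, and the set counted is always finite.\<close>

definition N_count :: "real \<Rightarrow> real \<Rightarrow> nat" where
  "N_count lam X = card {n :: nat. 1 \<le> n \<and> real n \<le> X \<and> omits_digit_2 (nat \<lfloor>lam * 2 ^ n\<rfloor>)}"

end

theory Submission
  imports Defs "HOL-Analysis.Kronecker_Approximation_Theorem"
begin

text \<open>Dirichlet's theorem gives \<open>k \<le> 3 ^ m\<close> with \<open>k * log 3 2\<close> within \<open>3 powr - m\<close> of an integer \<open>h\<close>.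
  Along \<open>n = r + k * j\<close> with \<open>j < 3 ^ m\<close>, the numbers \<open>lam * 2 ^ n\<close> are, up to the digit shift
  \<open>3 ^ (h * j)\<close>, terms of a geometric sequence of ratio \<open>2 ^ k / 3 ^ h\<close> that varies by a factor
  at most 3, hence is nearly an arithmetic progression. Whatever its step is, on the scale of the largest
  power of 3 below the step the terms have distinct integer parts in a window of length \<open>O(3 ^ m)\<close>,
  and only \<open>O(2 ^ m)\<close> integers in such a window omit the digit 2. The step is at least 1 as soon as
  \<open>n \<ge> k + O(1)\<close>, since \<open>2 ^ k \<noteq> 3 ^ h\<close>, so no irrationality measure of \<open>log 3 2\<close> is needed.
  With \<open>9 ^ m \<le> X < 9 ^ (m + 1)\<close>, the range \<open>n \<le> X\<close> is covered by \<open>O(3 ^ m)\<close> such progressions and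
  \<open>O(3 ^ m)\<close> initial values, for a total of \<open>O(6 ^ m)\<close>, while \<open>X powr 0.9725 \<ge> 8 ^ m\<close>.\<close>

section \<open>Integers whose ternary expansion omits the digit 2\<close>

lemma omits_digit_2_div: "omits_digit_2 n \<Longrightarrow> omits_digit_2 (n div 3 ^ t)"
  unfolding omits_digit_2_def ternary_digit_def
  by (metis div_mult2_eq power_add)

lemma omits_digit_2_mod:
  assumes "omits_digit_2 n"
  shows "omits_digit_2 (n mod 3 ^ t)"
  unfolding omits_digit_2_def ternary_digit_def
proof
  fix i
  have eq: "n mod 3 ^ t div 3 ^ i mod 3 = n div 3 ^ i mod 3" if it: "i < t"
  proof -
    obtain d where t: "t = i + Suc d"
      using it less_imp_Suc_add by auto
    have "n mod (3 ^ i * 3 ^ Suc d) div 3 ^ i = n div 3 ^ i mod 3 ^ Suc d"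
      by (simp add: mod_mult2_eq)
    then show ?thesis
      unfolding t power_add by (simp add: mod_mod_cancel)
  qed
  have zero: "n mod 3 ^ t div 3 ^ i = 0" if "t \<le> i"
  proof -
    have "n mod 3 ^ t < 3 ^ t" by simp
    also have "(3::nat) ^ t \<le> 3 ^ i" using that by (intro power_increasing) auto
    finally show ?thesis by simp
  qed
  show "n mod 3 ^ t div 3 ^ i mod 3 \<noteq> 2"
    using eq zero assms unfolding omits_digit_2_def ternary_digit_def
    by (cases "i < t") auto
qed

lemma card_omits_digit_2_less: "card {n. n < 3 ^ m \<and> omits_digit_2 n} \<le> 2 ^ m"
proof (induction m)
  case 0
  have "{n. n < 3 ^ 0 \<and> omits_digit_2 n} \<subseteq> {0}" by auto
  from card_mono[OF _ this] show ?case by simp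
next
  case (Suc m)
  let ?S = "\<lambda>m. {n. n < 3 ^ m \<and> omits_digit_2 n}"
  have fin: "finite (?S m)" for m by simp
  have "(\<lambda>n. (n div 3, n mod 3)) ` ?S (Suc m) \<subseteq> ?S m \<times> {0, 1}"
  proof clarsimp
    fix n :: nat
    assume n: "n < 3 * 3 ^ m" "omits_digit_2 n"
    have "n mod 3 \<noteq> 2" "n mod 3 < 3"
      using n(2) unfolding omits_digit_2_def ternary_digit_def by (auto dest: spec[of _ 0])
    then show "n div 3 < 3 ^ m \<and> omits_digit_2 (n div 3) \<and> (n mod 3 = 0 \<or> n mod 3 = Suc 0)"
      using n omits_digit_2_div[of n 1] by auto
  qed
  moreover have "inj_on (\<lambda>n. (n div 3, n mod 3)) (?S (Suc m))"
    by (rule inj_onI) (metis Pair_inject div_mult_mod_eq)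
  ultimately have "card (?S (Suc m)) \<le> card (?S m \<times> {0, 1::nat})"
    using fin by (intro card_inj_on_le) auto
  then show ?case
    using Suc.IH by (simp add: card_cartesian_product)
qed

text \<open>Such a set meets at most two consecutive blocks
  \<open>[q * 3 ^ m, (q + 1) * 3 ^ m)\<close>. Inside a block an element is determined by its last
  \<open>m\<close> digits, which again omit 2.\<close>

lemma card_omits_digit_2_close:
  fixes S :: "nat set"
  assumes omits: "\<And>v. v \<in> S \<Longrightarrow> omits_digit_2 v"
    and close: "\<And>v w. v \<in> S \<Longrightarrow> w \<in> S \<Longrightarrow> v \<le> w + 3 ^ m"
  shows "card S \<le> 2 * 2 ^ m"
proof (cases "S = {}")
  case False
  define a where "a = (LEAST v. v \<in> S)"
  have a: "a \<in> S" "\<And>v. v \<in> S \<Longrightarrow> a \<le> v"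
    using False unfolding a_def by (auto intro: LeastI Least_le)
  let ?M = "3 ^ m :: nat"
  let ?f = "\<lambda>v. (v div ?M, v mod ?M)"
  let ?T = "{n. n < ?M \<and> omits_digit_2 n}"
  have "?f ` S \<subseteq> {a div ?M, Suc (a div ?M)} \<times> ?T"
  proof
    fix p assume "p \<in> ?f ` S"
    then obtain v where v: "v \<in> S" "p = ?f v" by auto
    have "a div ?M \<le> v div ?M" using a v by (intro div_le_mono) auto
    moreover have "v div ?M \<le> (a + ?M) div ?M" using close a v by (intro div_le_mono) auto
    ultimately have "v div ?M = a div ?M \<or> v div ?M = Suc (a div ?M)" by auto
    then show "p \<in> {a div ?M, Suc (a div ?M)} \<times> ?T"
      using v omits omits_digit_2_mod by auto
  qed
  moreover have "inj_on ?f S"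
    by (rule inj_onI) (metis Pair_inject div_mult_mod_eq)
  ultimately have "card S \<le> card ({a div ?M, Suc (a div ?M)} \<times> ?T)"
    by (intro card_inj_on_le) auto
  also have "\<dots> = 2 * card ?T"
    by (simp add: card_cartesian_product)
  finally show ?thesis
    using card_omits_digit_2_less[of m] by linarith
qed auto

section \<open>Nearly arithmetic progressions and digit shifts\<close>

text \<open>Mean value theorem: the derivative \<open>3 powr z * ln 3\<close> lies between
  \<open>ln 3 / 3\<close> and \<open>3 * ln 3\<close> for \<open>z\<close> in [-1, 1].\<close>

lemma powr3_diff_bounds:
  fixes u v :: real
  assumes "\<bar>u\<bar> \<le> 1" "\<bar>v\<bar> \<le> 1"
  shows "ln 3 / 3 * \<bar>u - v\<bar> \<le> \<bar>3 powr u - 3 powr v\<bar>"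
    and "\<bar>3 powr u - 3 powr v\<bar> \<le> 3 * ln 3 * \<bar>u - v\<bar>"
proof -
  have main: "ln 3 / 3 * (b - a) \<le> 3 powr b - 3 powr a \<and> 3 powr b - 3 powr a \<le> 3 * ln 3 * (b - a)"
    if "a < b" "\<bar>a\<bar> \<le> 1" "\<bar>b\<bar> \<le> 1" for a b :: real
  proof -
    have "\<exists>z>a. z < b \<and> (3::real) powr b - 3 powr a = (b - a) * (3 powr z * ln 3)"
      by (rule MVT2[OF that(1)]) (auto intro!: derivative_eq_intros simp: field_simps powr_def)
    then obtain z where z: "a < z" "z < b" "(3::real) powr b - 3 powr a = (b - a) * (3 powr z * ln 3)"
      by blast
    have "3 powr z \<le> (3::real) powr 1" "(3::real) powr (-1) \<le> 3 powr z"
      using z that by (intro powr_mono; simp)+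
    then have zb: "3 powr z \<le> (3::real)" "1 / 3 \<le> (3::real) powr z"
      by (simp_all add: powr_minus_divide)
    have pos: "0 \<le> (b - a) * ln 3" using that by simp
    show ?thesis
      unfolding z(3)
      using mult_left_mono[OF zb(1) pos] mult_left_mono[OF zb(2) pos] by (simp add: mult_ac)
  qed
  show "ln 3 / 3 * \<bar>u - v\<bar> \<le> \<bar>3 powr u - 3 powr v\<bar>"
    using main[of u v] main[of v u] assms by (cases u v rule: linorder_cases) (auto simp: algebra_simps)
  show "\<bar>3 powr u - 3 powr v\<bar> \<le> 3 * ln 3 * \<bar>u - v\<bar>"
    using main[of u v] main[of v u] assms by (cases u v rule: linorder_cases) (auto simp: algebra_simps)
qed

text \<open>Scaling by a power of 3 moves the ternary point, so the integer part on the coarse scale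
  arises from that on the fine scale by dropping the last \<open>t + d\<close> digits.\<close>

lemma nat_floor_shift:
  fixes y :: real
  assumes "0 \<le> y"
  shows "nat \<lfloor>y / 3 ^ t\<rfloor> = nat \<lfloor>y * 3 ^ d\<rfloor> div 3 ^ (t + d)"
proof -
  have "y / 3 ^ t = (y * 3 ^ d) / real_of_int (3 ^ (t + d))"
    by (simp add: power_add)
  then have "\<lfloor>y / 3 ^ t\<rfloor> = \<lfloor>y * 3 ^ d\<rfloor> div 3 ^ (t + d)"
    using floor_divide_real_eq_div[of "3 ^ (t + d)" "y * 3 ^ d"] by simp
  then show ?thesis
    using assms by (simp add: nat_div_distrib nat_power_eq)
qed

lemma exists_power3_scale:
  fixes s :: real
  assumes "1 \<le> s"
  obtains t :: nat where "3 ^ t \<le> s" "s < 3 ^ Suc t"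
proof -
  obtain n where "s < (3::real) ^ n"
    using real_arch_pow[of 3 s] by auto
  define t where "t = (LEAST n. s < (3::real) ^ Suc n)"
  have ex: "s < (3::real) ^ Suc n"
    using \<open>s < 3 ^ n\<close> by (rule less_le_trans) simp
  have 1: "s < 3 ^ Suc t" unfolding t_def by (rule LeastI[of _ n]) (rule ex)
  have 2: "3 ^ t \<le> s"
  proof (cases t)
    case (Suc t')
    then have "\<not> s < (3::real) ^ Suc t'"
      using not_less_Least[of t' "\<lambda>n. s < (3::real) ^ Suc n"] unfolding t_def by simp
    then show ?thesis using Suc by simp
  qed (use assms in simp)
  show ?thesis using that 1 2 by blast
qed

text \<open>Without the digit shift \<open>3 ^ (h * j)\<close>, terms \<open>i\<close> and
  \<open>j\<close> differ by between \<open>s * \<bar>i - j\<bar>\<close> and nine times that, where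
  \<open>s\<close> is the left-hand separation in \<open>sep\<close>. Dividing by the power of 3
  just below \<open>s\<close> gives distinct integer parts in a window of length
  \<open>3 ^ (m + 3)\<close>.\<close>

lemma card_geometric_omits:
  fixes x \<eta> :: real and h m :: nat
  assumes x: "0 < x" and \<eta>: "\<bar>\<eta>\<bar> * 3 ^ m \<le> 1" and sep: "1 \<le> x * \<bar>\<eta>\<bar> * ln 3 / 3"
  shows "card {j. j < 3 ^ m \<and> omits_digit_2 (nat \<lfloor>x * 3 powr (\<eta> * real j) * 3 ^ (h * j)\<rfloor>)} \<le> 16 * 2 ^ m"
    (is "card ?A \<le> _")
proof -
  define y where "y j = x * 3 powr (\<eta> * real j)" for j
  define s where "s = x * \<bar>\<eta>\<bar> * ln 3 / 3"
  obtain t where t: "3 ^ t \<le> s" "s < 3 ^ Suc t"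
    using exists_power3_scale[of s] sep unfolding s_def by blast
  define v where "v j = nat \<lfloor>y j / 3 ^ t\<rfloor>" for j
  have s_pos: "0 < s" using sep unfolding s_def by linarith
  have y_pos: "0 < y j" for j using x unfolding y_def by simp
  have exp_le: "\<bar>\<eta> * real j\<bar> \<le> 1" if "j < 3 ^ m" for j
  proof -
    have "real j \<le> real (3 ^ m)" using that by (subst of_nat_le_iff) simp
    then have "\<bar>\<eta>\<bar> * real j \<le> \<bar>\<eta>\<bar> * 3 ^ m" by (intro mult_left_mono) auto
    then show ?thesis using \<eta> by (simp add: abs_mult)
  qed
  have y_diff: "\<bar>y i - y j\<bar> = x * \<bar>3 powr (\<eta> * real i) - 3 powr (\<eta> * real j)\<bar>"
    for i j
    using x unfolding y_def by (simp add: abs_mult flip: right_diff_distrib)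
  have e_diff: "\<bar>\<eta> * real i - \<eta> * real j\<bar> = \<bar>\<eta>\<bar> * \<bar>real i - real j\<bar>" for i j
    by (simp add: abs_mult flip: right_diff_distrib)
  have lower: "s * \<bar>real i - real j\<bar> \<le> \<bar>y i - y j\<bar>" if "i < 3 ^ m" "j < 3 ^ m" for i j
    using mult_left_mono[OF powr3_diff_bounds(1)[OF exp_le[OF that(1)] exp_le[OF that(2)]], of x] x
    unfolding y_diff e_diff s_def by (simp add: algebra_simps)
  have upper: "\<bar>y i - y j\<bar> \<le> 9 * s * \<bar>real i - real j\<bar>" if "i < 3 ^ m" "j < 3 ^ m" for i j
    using mult_left_mono[OF powr3_diff_bounds(2)[OF exp_le[OF that(1)] exp_le[OF that(2)]], of x] x
    unfolding y_diff e_diff s_def by (simp add: algebra_simps)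
  have fl: "real (v j) \<le> y j / 3 ^ t \<and> y j / 3 ^ t < real (v j) + 1" for j
  proof -
    have "0 \<le> y j / 3 ^ t" using y_pos[of j] by simp
    then have "real (v j) = real_of_int \<lfloor>y j / 3 ^ t\<rfloor>"
      unfolding v_def by (intro of_nat_nat) simp
    then show ?thesis by linarith
  qed
  have "inj_on v ?A"
  proof (rule inj_onI, rule ccontr)
    fix i j assume ij: "i \<in> ?A" "j \<in> ?A" "v i = v j" "i \<noteq> j"
    have "\<bar>y i / 3 ^ t - y j / 3 ^ t\<bar> < 1" using fl[of i] fl[of j] ij(3) by linarith
    then have "\<bar>y i - y j\<bar> < 3 ^ t" by (simp add: field_simps flip: diff_divide_distrib)
    moreover have "1 \<le> \<bar>real i - real j\<bar>" using ij(4) by linarith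
    then have "s * 1 \<le> s * \<bar>real i - real j\<bar>" using s_pos by (intro mult_left_mono) auto
    ultimately show False using lower[of i j] ij t by auto
  qed
  then have "card ?A = card (v ` ?A)" by (simp add: card_image)
  also have "\<dots> \<le> 2 * 2 ^ (m + 3)"
  proof (rule card_omits_digit_2_close)
    fix w assume "w \<in> v ` ?A"
    then obtain j where j: "j \<in> ?A" "w = v j" by auto
    \<comment> \<open>The hypothesis concerns the term with the shift \<open>3 ^ (h * j)\<close>;
      dropping its last \<open>t + h * j\<close> digits leaves \<open>v j\<close>, which therefore
      omits 2 as well.\<close>
    have "w = nat \<lfloor>y j * 3 ^ (h * j)\<rfloor> div 3 ^ (t + h * j)"
      unfolding j(2) v_def using y_pos[of j] by (intro nat_floor_shift) simp
    then show "omits_digit_2 w"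
      using j(1) omits_digit_2_div unfolding y_def by simp
  next
    fix w w' assume "w \<in> v ` ?A" "w' \<in> v ` ?A"
    then obtain i j where ij: "i < 3 ^ m" "j < 3 ^ m" "w = v i" "w' = v j" by auto
    have "real i < real (3 ^ m)" "real j < real (3 ^ m)"
      using ij(1,2) by (simp_all only: of_nat_less_iff)
    then have "\<bar>real i - real j\<bar> \<le> real (3 ^ m)" by linarith
    then have "\<bar>real i - real j\<bar> \<le> 3 ^ m" by simp
    \<comment> \<open>The factor 9 from \<open>upper\<close> and the 3 in
      \<open>s < 3 ^ Suc t\<close> make up the three extra digits in \<open>m + 3\<close>.\<close>
    then have "9 * s * \<bar>real i - real j\<bar> \<le> (9 * 3 ^ Suc t) * 3 ^ m"
      using s_pos t by (intro mult_mono) auto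
    then have "y i - y j \<le> 3 ^ (m + 3) * 3 ^ t"
      using upper[OF ij(1,2)] by (simp add: power_add)
    then have "y i / 3 ^ t - y j / 3 ^ t \<le> 3 ^ (m + 3)"
      by (simp add: field_simps flip: diff_divide_distrib)
    \<comment> \<open>The floors cost less than 1, which the strict inequality between integers
      absorbs.\<close>
    then have "real w < real (w' + 3 ^ (m + 3) + 1)"
      using fl[of i] fl[of j] ij by simp
    then show "w \<le> w' + 3 ^ (m + 3)" unfolding of_nat_less_iff by simp
  qed
  finally show ?thesis by (simp add: power_add)
qed

section \<open>Diophantine approximation of \<open>log 3 2\<close>\<close>

text \<open>By parity \<open>2 ^ k\<close> and \<open>3 ^ h\<close> differ by at least 1. With
  \<open>\<eta>\<close> the linear form, the difference is
  \<open>3 ^ h * \<bar>3 powr \<eta> - 1\<bar>\<close>, where \<open>3 ^ h \<le> 3 * 2 ^ k\<close>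
  and the second factor is at most \<open>3 * ln 3 * \<bar>\<eta>\<bar>\<close>.\<close>

lemma log32_form_lower:
  fixes k h :: nat
  assumes "0 < k" and small: "\<bar>real k * log 3 2 - real h\<bar> \<le> 1"
  shows "1 \<le> 9 * 2 ^ k * ln 3 * \<bar>real k * log 3 2 - real h\<bar>"
proof -
  define \<eta> where "\<eta> = real k * log 3 2 - real h"
  have e: "3 powr \<eta> * 3 ^ h = 2 ^ k"
  proof -
    have "3 powr \<eta> * 3 ^ h = 3 powr (\<eta> + real h)"
      by (simp add: powr_add powr_realpow)
    also have "\<dots> = (3 powr log 3 2) powr real k"
      unfolding \<eta>_def powr_powr by (simp add: mult.commute)
    finally show ?thesis by (simp add: powr_realpow)
  qed
  have "even ((2::int) ^ k)" "odd ((3::int) ^ h)" using assms by auto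
  then have "(2::int) ^ k \<noteq> 3 ^ h" by metis
  then have "1 \<le> \<bar>(2::int) ^ k - 3 ^ h\<bar>" by linarith
  then have "1 \<le> \<bar>(2::real) ^ k - 3 ^ h\<bar>"
    using of_int_le_iff[of 1 "\<bar>(2::int) ^ k - 3 ^ h\<bar>", where 'a = real] by simp
  also have "(2::real) ^ k - 3 ^ h = (3 powr \<eta> - 3 powr 0) * 3 ^ h"
    using e by (simp add: algebra_simps)
  also have "\<bar>\<dots>\<bar> = \<bar>3 powr \<eta> - 3 powr 0\<bar> * 3 ^ h" by (simp add: abs_mult)
  also have "\<dots> \<le> (3 * ln 3 * \<bar>\<eta>\<bar>) * (3 * 2 ^ k)"
  proof (rule mult_mono)
    show "\<bar>3 powr \<eta> - 3 powr 0\<bar> \<le> 3 * ln 3 * \<bar>\<eta>\<bar>"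
      using powr3_diff_bounds(2)[of \<eta> 0] small unfolding \<eta>_def by simp
    have "(3::real) powr (-1) \<le> 3 powr \<eta>"
      using small unfolding \<eta>_def by (intro powr_mono) auto
    then have "1 / 3 * 3 ^ h \<le> 3 powr \<eta> * 3 ^ h"
      by (intro mult_right_mono) (simp_all add: powr_minus_divide)
    then show "(3::real) ^ h \<le> 3 * 2 ^ k" unfolding e by simp
  qed auto
  finally show ?thesis unfolding \<eta>_def by (simp add: algebra_simps)
qed

lemma log32_approx:
  obtains k h :: nat where "0 < k" "k \<le> 3 ^ m" "\<bar>real k * log 3 2 - real h\<bar> * 3 ^ m \<le> 1"
proof -
  obtain h k :: int where hk: "0 < k" "k \<le> int (3 ^ m)" "\<bar>of_int k * log 3 2 - of_int h\<bar> < 1 / real (3 ^ m)"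
    by (rule Dirichlet_approx[of "3 ^ m" "log 3 2"]) auto
  \<comment> \<open>Dirichlet's theorem yields integers; \<open>h\<close> exceeds a positive number
    minus 1, so it is a natural number.\<close>
  have "1 / real (3 ^ m) \<le> 1" by (simp add: divide_le_eq)
  moreover have "0 < of_int k * log 3 (2::real)" using hk by simp
  ultimately have "- 1 < real_of_int h" using hk(3) by linarith
  then have "0 \<le> h" by linarith
  then have "\<bar>real (nat k) * log 3 2 - real (nat h)\<bar> * 3 ^ m \<le> 1"
    using hk by (simp add: field_simps)
  then show ?thesis
    using that[of "nat k" "nat h"] hk by (simp add: nat_le_iff)
qed

section \<open>Counting exponents\<close>

text \<open>The constant 27 is 3 * 9: \<open>log32_form_lower\<close> bounds
  \<open>\<bar>\<eta>\<bar> * ln 3\<close> below by \<open>1 / (9 * 2 ^ k)\<close>, and the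
  separation condition asks for \<open>x * \<bar>\<eta>\<bar> * ln 3 \<ge> 3\<close>, so
  \<open>x \<ge> 27 * 2 ^ k\<close> suffices.\<close>

lemma card_omits_progression:
  fixes lam :: real
  assumes lam: "27 \<le> lam * 2 ^ c" "0 < lam" and k: "0 < k" "k + c \<le> r"
    and small: "\<bar>real k * log 3 2 - real h\<bar> * 3 ^ m \<le> 1"
  shows "card {j. j < 3 ^ m \<and> omits_digit_2 (nat \<lfloor>lam * 2 ^ (r + k * j)\<rfloor>)} \<le> 16 * 2 ^ m"
proof -
  define \<eta> where "\<eta> = real k * log 3 2 - real h"
  define x where "x = lam * 2 ^ r"
  have "\<bar>\<eta>\<bar> * 1 \<le> \<bar>\<eta>\<bar> * 3 ^ m" by (intro mult_left_mono) auto
  also have "\<dots> \<le> 1" using small unfolding \<eta>_def .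
  finally have "\<bar>\<eta>\<bar> \<le> 1" by simp
  then have low: "1 \<le> 9 * 2 ^ k * ln 3 * \<bar>\<eta>\<bar>"
    using log32_form_lower[OF k(1), of h] unfolding \<eta>_def by simp
  have "27 * 2 ^ k \<le> lam * 2 ^ c * 2 ^ k" using lam by (intro mult_right_mono) auto
  also have "\<dots> = lam * 2 ^ (k + c)" by (simp add: power_add)
  also have "\<dots> \<le> x" unfolding x_def using lam k by (intro mult_left_mono power_increasing) auto
  finally have "27 * 2 ^ k * (\<bar>\<eta>\<bar> * ln 3) \<le> x * (\<bar>\<eta>\<bar> * ln 3)" by (intro mult_right_mono) auto
  then have sep: "1 \<le> x * \<bar>\<eta>\<bar> * ln 3 / 3" using low by (simp add: algebra_simps)
  have eq: "lam * 2 ^ (r + k * j) = x * 3 powr (\<eta> * real j) * 3 ^ (h * j)" for j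
  proof -
    have "3 powr (\<eta> * real j) * 3 ^ (h * j) = 3 powr (\<eta> * real j + real (h * j))"
      by (simp only: powr_add powr_realpow zero_less_numeral)
    also have "\<eta> * real j + real (h * j) = log 3 2 * real (k * j)"
      unfolding \<eta>_def by (simp add: algebra_simps)
    also have "3 powr (log 3 2 * real (k * j)) = (3 powr log 3 2) powr real (k * j)"
      by (simp only: powr_powr)
    also have "\<dots> = 2 ^ (k * j)" by (simp add: powr_realpow del: of_nat_mult)
    finally show ?thesis unfolding x_def by (simp add: power_add)
  qed
  have "0 < x" unfolding x_def using lam by simp
  then show ?thesis
    unfolding eq using small[folded \<eta>_def] sep by (rule card_geometric_omits)
qed

text \<open>Exponents below \<open>k + c\<close> are counted trivially. The others are cut into
  blocks of length \<open>L = k * 3 ^ m\<close>, and each block into \<open>k\<close> residue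
  classes, which are progressions of \<open>3 ^ m\<close> terms.\<close>

lemma card_omits_upto:
  fixes lam :: real
  assumes lam: "27 \<le> lam * 2 ^ c" "0 < lam" and N: "N \<le> 9 * 9 ^ m"
  shows "card {n. n \<le> N \<and> omits_digit_2 (nat \<lfloor>lam * 2 ^ n\<rfloor>)} \<le> (c + 161) * 6 ^ m"
proof -
  obtain k h where k: "0 < k" "k \<le> 3 ^ m" and small: "\<bar>real k * log 3 2 - real h\<bar> * 3 ^ m \<le> 1"
    using log32_approx by blast
  define P where "P n \<longleftrightarrow> omits_digit_2 (nat \<lfloor>lam * 2 ^ n\<rfloor>)" for n
  define L where "L = k * 3 ^ m"
  define r where "r = (\<lambda>(b, e). k + c + b * L + e)"
  define I where "I = {..N div L} \<times> {..<k}"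
  define B where "B i = (\<lambda>j. r i + k * j) ` {j. j < 3 ^ m \<and> P (r i + k * j)}" for i
  have L: "0 < L" unfolding L_def using k by simp
  have cover: "{n. n \<le> N \<and> P n} \<subseteq> {..<k + c} \<union> (\<Union>i\<in>I. B i)"
  proof
    fix n assume n: "n \<in> {n. n \<le> N \<and> P n}"
    show "n \<in> {..<k + c} \<union> (\<Union>i\<in>I. B i)"
    proof (cases "n < k + c")
      case False
      define d where "d = n - (k + c)"
      \<comment> \<open>Mixed-radix expansion of \<open>d\<close>: block number, residue modulo
        \<open>k\<close>, and position \<open>j\<close> in the progression.\<close>
      define i where "i = (d div L, d mod L mod k)"
      define j where "j = d mod L div k"
      have "d mod L < k * 3 ^ m" using L unfolding L_def by simp
      then have j: "j < 3 ^ m" unfolding j_def by (simp add: less_mult_imp_div_less mult.commute)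
      have "d div L * L + (d mod L mod k + k * (d mod L div k)) = d"
        by simp
      then have n_eq: "n = r i + k * j"
        using False unfolding r_def i_def j_def d_def by simp
      have "d div L \<le> N div L" using n unfolding d_def by (intro div_le_mono) auto
      then have "i \<in> I" unfolding I_def i_def using k by simp
      moreover have "n \<in> B i" unfolding B_def using j n n_eq by auto
      ultimately show ?thesis by auto
    qed auto
  qed
  have B: "card (B i) \<le> 16 * 2 ^ m" for i
  proof -
    have "card (B i) \<le> card {j. j < 3 ^ m \<and> P (r i + k * j)}"
      unfolding B_def by (intro card_image_le) simp
    also have "\<dots> \<le> 16 * 2 ^ m"
      unfolding P_def
      by (rule card_omits_progression[OF lam k(1) _ small]) (auto simp: r_def split: prod.split)
    finally show ?thesis .
  qed
  have finI: "finite I" unfolding I_def by simp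
  \<comment> \<open>The \<open>k\<close> classes per block cancel the factor \<open>k\<close> in
    \<open>L\<close>, so the bound does not depend on the size of \<open>k\<close>.\<close>
  have "N div L * k \<le> 9 * 3 ^ m"
  proof -
    have "N div L * k * 3 ^ m \<le> N" using div_times_less_eq_dividend[of N L] unfolding L_def by (simp add: mult_ac)
    also have "(9::nat) ^ m = 3 ^ m * 3 ^ m" by (simp flip: power_mult_distrib)
    then have "N \<le> (9 * 3 ^ m) * 3 ^ m" using N by simp
    finally show ?thesis by simp
  qed
  then have cardI: "card I \<le> 10 * 3 ^ m"
    unfolding I_def using k by simp
  have "card {n. n \<le> N \<and> P n} \<le> card ({..<k + c} \<union> (\<Union>i\<in>I. B i))"
    using finI by (intro card_mono[OF _ cover]) (auto simp: B_def)
  also have "\<dots> \<le> card {..<k + c} + card (\<Union>i\<in>I. B i)"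
    by (rule card_Un_le)
  also have "card (\<Union>i\<in>I. B i) \<le> (\<Sum>i\<in>I. card (B i))"
    using finI by (rule card_UN_le)
  also have "\<dots> \<le> card I * (16 * 2 ^ m)"
    using sum_bounded_above[of I "\<lambda>i. card (B i)" "16 * 2 ^ m"] B by simp
  also have "\<dots> \<le> (10 * 3 ^ m) * (16 * 2 ^ m)"
    using cardI by (intro mult_right_mono) auto
  also have "\<dots> = 160 * 6 ^ m" by (simp flip: power_mult_distrib)
  finally have "card {n. n \<le> N \<and> P n} \<le> k + c + 160 * 6 ^ m" by simp
  moreover have "k \<le> 6 ^ m"
    using k(2) power_mono[of 3 "6::nat" m] by linarith
  moreover have "c \<le> c * 6 ^ m" by simp
  ultimately show ?thesis unfolding P_def add_mult_distrib by linarith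
qed

theorem theorem1p1:
  fixes lam :: real
  assumes "lam > 0"
  shows "\<exists>n0 :: real. \<forall>X :: real. X \<ge> n0 \<longrightarrow> real (N_count lam X) \<le> 25 * X powr 0.9725"
proof -
  obtain c where "27 / lam < 2 ^ c" using real_arch_pow[of 2 "27 / lam"] by auto
  then have c: "27 \<le> lam * 2 ^ c" using assms by (simp add: field_simps)
  \<comment> \<open>From \<open>m0\<close> on, the constant depending on \<open>lam\<close> is
    absorbed by passing from \<open>6 ^ m\<close> to \<open>8 ^ m\<close>.\<close>
  obtain m0 where "real (c + 161) < (8 / 6) ^ m0"
    using real_arch_pow[of "8 / 6" "real (c + 161)"] by auto
  show ?thesis
  proof (intro exI allI impI)
    fix X :: real
    assume X: "9 ^ m0 \<le> X"
    have "1 \<le> X" using X one_le_power[of "9::real" m0] by linarith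
    define m where "m = nat \<lfloor>log 9 X\<rfloor>"
    have "0 \<le> log 9 X" using \<open>1 \<le> X\<close> by simp
    then have m: "real m \<le> log 9 X" "log 9 X < real (Suc m)" unfolding m_def by linarith+
    have X_low: "9 ^ m \<le> X"
      using m(1) \<open>1 \<le> X\<close> by (simp add: le_log_iff powr_realpow)
    have X_up: "X < 9 ^ Suc m"
      using m(2) \<open>1 \<le> X\<close> by (simp add: log_less_iff powr_realpow powr_add)
    have "(9::real) ^ m0 < 9 ^ Suc m" using X X_up by linarith
    then have "m0 < Suc m" by (subst (asm) power_strict_increasing_iff) auto
    then have "m0 \<le> m" by simp
    have "real (c + 161) \<le> (8 / 6) ^ m0" using \<open>real (c + 161) < _\<close> by simp
    also have "\<dots> \<le> (8 / 6) ^ m" using \<open>m0 \<le> m\<close> by (intro power_increasing) auto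
    finally have "real (c + 161) * 6 ^ m \<le> (8 / 6) ^ m * 6 ^ m" by (intro mult_right_mono) auto
    also have "(8 / 6) ^ m * 6 ^ m = (8::real) ^ m" by (simp flip: power_mult_distrib)
    finally have growth: "real (c + 161) * 6 ^ m \<le> 8 ^ m" .
    have "N_count lam X \<le> card {n. n \<le> nat \<lfloor>X\<rfloor> \<and> omits_digit_2 (nat \<lfloor>lam * 2 ^ n\<rfloor>)}"
      unfolding N_count_def by (intro card_mono) (auto simp: le_nat_floor)
    also have "\<dots> \<le> (c + 161) * 6 ^ m"
    proof (rule card_omits_upto[OF c assms])
      have "real (nat \<lfloor>X\<rfloor>) \<le> X" using \<open>1 \<le> X\<close> by simp
      also have "X < real (9 * 9 ^ m)" using X_up by simp
      finally show "nat \<lfloor>X\<rfloor> \<le> 9 * 9 ^ m" unfolding of_nat_less_iff by simp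
    qed
    finally have "real (N_count lam X) \<le> real ((c + 161) * 6 ^ m)" by (simp only: of_nat_le_iff)
    also have "\<dots> \<le> 8 ^ m" using growth by simp
    also have "(8::real) ^ m \<le> (9 powr 0.9725) ^ m"
    proof (rule power_mono)
      \<comment> \<open>Since 0.95 = 19/20, this is the integer comparison of \<open>8 ^ 20\<close>
        with \<open>9 ^ 19\<close>.\<close>
      have "(8::real) ^ 20 \<le> (9 powr 0.95) ^ 20"
        by (simp add: powr_realpow[symmetric] powr_powr)
      then have "(8::real) \<le> 9 powr 0.95"
        by (rule power_le_imp_le_base[of _ 19, simplified]) simp
      also have "\<dots> \<le> 9 powr 0.9725" by (intro powr_mono) auto
      finally show "(8::real) \<le> 9 powr 0.9725" .
    qed simp
    also have "\<dots> = (9 ^ m) powr 0.9725"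
      by (simp add: powr_powr mult.commute flip: powr_realpow)
    also have "\<dots> \<le> X powr 0.9725"
      using X_low by (intro powr_mono2) auto
    also have "\<dots> \<le> 25 * X powr 0.9725" by simp
    finally show "real (N_count lam X) \<le> 25 * X powr 0.9725" .
  qed
qed

end
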